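(* Let $(M,g)$ be a stochastically complete Riemannian manifold and $u:M\to\mathbb{R}^n$ a minimal immersion. (a) The image $u(M)$ is unbounded. (b) Let $P:\mathbb{R}^n\to\mathbb{R}^n$ be an orthogonal projection. If $\mathrm{rk}\,u+\mathrm{rk}\,P-n\ge 1$, then $P\circ u$ is unbounded.
   Context: $M$ is connected, without boundary, not assumed complete. $(M,g)$ is stochastically complete if for every $F\in\mathscr{C}^2(M)$ bounded above there is a sequence $(p_k)$ with $F(p_k)>\sup F-1/k$ and $\Delta_MF(p_k)<1/k$. A minimal immersion is an isometric immersion ($u^*\langle\cdot,\cdot\rangle=g$) with vanishing mean curvature. $\mathrm{rk}$ denotes the rank of the differential (so $\mathrm{rk}\,u=\dim M$). *)

theory Defs
  imports "HOL-Analysis.Analysis"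
begin

section \<open>Calculus in coordinates\<close>

text \<open>i-th partial derivative of a real function on real^'m.\<close>
definition pd :: "'m::finite \<Rightarrow> (real^'m \<Rightarrow> real) \<Rightarrow> real^'m \<Rightarrow> real" where
  "pd i f x = deriv (\<lambda>t. f (x + t *\<^sub>R axis i 1)) 0"

text \<open>componentwise partial derivative of a vector-valued function\<close>
definition pdv :: "'m::finite \<Rightarrow> (real^'m \<Rightarrow> real^'n) \<Rightarrow> real^'m \<Rightarrow> real^'n" where
  "pdv i f x = (\<chi> a. pd i (\<lambda>y. f y $ a) x)"

text \<open>C^k functions on an open set (all partial derivatives up to order k exist and are continuous)\<close>
fun Ck :: "nat \<Rightarrow> (real^'m::finite) set \<Rightarrow> (real^'m \<Rightarrow> real) \<Rightarrow> bool" where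
  "Ck 0 U f = continuous_on U f"
| "Ck (Suc k) U f = (continuous_on U f \<and>
      (\<forall>i. (\<forall>x\<in>U. (\<lambda>t. f (x + t *\<^sub>R axis i 1)) differentiable (at 0)) \<and> Ck k U (pd i f)))"

definition CkV :: "nat \<Rightarrow> (real^'m::finite) set \<Rightarrow> (real^'m \<Rightarrow> real^'n) \<Rightarrow> bool" where
  "CkV k U f = (\<forall>a. Ck k U (\<lambda>x. f x $ a))"

definition smooth_on :: "(real^'m::finite) set \<Rightarrow> (real^'m \<Rightarrow> real) \<Rightarrow> bool" where
  "smooth_on U f = (\<forall>k. Ck k U f)"

definition smoothV_on :: "(real^'m::finite) set \<Rightarrow> (real^'m \<Rightarrow> real^'n) \<Rightarrow> bool" where
  "smoothV_on U f = (\<forall>k. CkV k U f)"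

section \<open>Smooth manifolds via atlases\<close>

text \<open>A chart is a pair (U, phi): U open in M, phi a homeomorphism onto an open subset of real^'m.\<close>
type_synonym ('p,'m) chart = "'p set \<times> ('p \<Rightarrow> real^'m)"

definition is_chart :: "'p topology \<Rightarrow> ('p,'m::finite) chart \<Rightarrow> bool" where
  "is_chart T c = (openin T (fst c) \<and> open (snd c ` fst c) \<and>
      homeomorphic_map (subtopology T (fst c)) (top_of_set (snd c ` fst c)) (snd c))"

definition cdom :: "('p,'m::finite) chart \<Rightarrow> (real^'m) set" where
  "cdom c = snd c ` fst c"

definition cinv :: "('p,'m::finite) chart \<Rightarrow> real^'m \<Rightarrow> 'p" where
  "cinv c = inv_into (fst c) (snd c)"

text \<open>transition map from chart c1 to chart c2, defined on snd c1 ` (fst c1 \<inter> fst c2)\<close>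
definition trans_map :: "('p,'m::finite) chart \<Rightarrow> ('p,'m) chart \<Rightarrow> real^'m \<Rightarrow> real^'m" where
  "trans_map c1 c2 = snd c2 \<circ> cinv c1"

definition smooth_atlas :: "'p topology \<Rightarrow> ('p,'m::finite) chart set \<Rightarrow> bool" where
  "smooth_atlas T A =
     ((\<forall>c\<in>A. is_chart T c) \<and> (\<forall>p\<in>topspace T. \<exists>c\<in>A. p \<in> fst c) \<and>
      (\<forall>c1\<in>A. \<forall>c2\<in>A. smoothV_on (snd c1 ` (fst c1 \<inter> fst c2)) (trans_map c1 c2)))"

text \<open>A smooth manifold (Hausdorff, second countable, with a smooth atlas; dimension CARD('m) \<ge> 1).\<close>
definition smooth_manifold :: "'p topology \<Rightarrow> ('p,'m::finite) chart set \<Rightarrow> bool" where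
  "smooth_manifold T A = (Hausdorff_space T \<and> second_countable T \<and> smooth_atlas T A)"

text \<open>Functions on M of class C^k: smooth in every chart.\<close>
definition Ck_fun :: "nat \<Rightarrow> 'p topology \<Rightarrow> ('p,'m::finite) chart set \<Rightarrow> ('p \<Rightarrow> real) \<Rightarrow> bool" where
  "Ck_fun k T A F = (\<forall>c\<in>A. Ck k (cdom c) (F \<circ> cinv c))"

definition smooth_map :: "'p topology \<Rightarrow> ('p,'m::finite) chart set \<Rightarrow> ('p \<Rightarrow> real^'n) \<Rightarrow> bool" where
  "smooth_map T A u = (\<forall>c\<in>A. smoothV_on (cdom c) (u \<circ> cinv c))"

section \<open>Riemannian metrics in coordinates\<close>

text \<open>A Riemannian metric is given by its coordinate matrices gm c x (x \<in> cdom c) for each chart c: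
  smooth, symmetric, positive definite, and transforming as a (0,2)-tensor under changes of chart.\<close>
type_synonym ('p,'m) metric = "('p,'m) chart \<Rightarrow> real^'m \<Rightarrow> real^'m^'m"

definition riemannian_metric :: "'p topology \<Rightarrow> ('p,'m::finite) chart set \<Rightarrow> ('p,'m) metric \<Rightarrow> bool" where
  "riemannian_metric T A gm =
    ((\<forall>c\<in>A. \<forall>i j. smooth_on (cdom c) (\<lambda>x. gm c x $ i $ j)) \<and>
     (\<forall>c\<in>A. \<forall>x\<in>cdom c. \<forall>i j. gm c x $ i $ j = gm c x $ j $ i) \<and>
     (\<forall>c\<in>A. \<forall>x\<in>cdom c. \<forall>v. v \<noteq> 0 \<longrightarrow> v \<bullet> (gm c x *v v) > 0) \<and>
     (\<forall>c1\<in>A. \<forall>c2\<in>A. \<forall>x\<in>snd c1 ` (fst c1 \<inter> fst c2). \<forall>i j.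
        gm c1 x $ i $ j =
          (\<Sum>a\<in>UNIV. \<Sum>b\<in>UNIV. gm c2 (trans_map c1 c2 x) $ a $ b
              * pd i (\<lambda>y. trans_map c1 c2 y $ a) x * pd j (\<lambda>y. trans_map c1 c2 y $ b) x)))"

text \<open>Christoffel symbols Gamma^k_ij and the Laplace-Beltrami operator in a chart:
  Delta f = g^ij (d_i d_j f - Gamma^k_ij d_k f).\<close>
definition christoffel :: "('p,'m::finite) metric \<Rightarrow> ('p,'m) chart \<Rightarrow> real^'m \<Rightarrow> 'm \<Rightarrow> 'm \<Rightarrow> 'm \<Rightarrow> real" where
  "christoffel gm c x k i j =
     (1/2) * (\<Sum>l\<in>UNIV. matrix_inv (gm c x) $ k $ l *
        (pd i (\<lambda>y. gm c y $ j $ l) x + pd j (\<lambda>y. gm c y $ i $ l) x - pd l (\<lambda>y. gm c y $ i $ j) x))"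

definition laplacian_chart :: "('p,'m::finite) metric \<Rightarrow> ('p,'m) chart \<Rightarrow> (real^'m \<Rightarrow> real) \<Rightarrow> real^'m \<Rightarrow> real" where
  "laplacian_chart gm c f x =
     (\<Sum>i\<in>UNIV. \<Sum>j\<in>UNIV. matrix_inv (gm c x) $ i $ j *
        (pd j (pd i f) x - (\<Sum>k\<in>UNIV. christoffel gm c x k i j * pd k f x)))"

text \<open>Laplace-Beltrami operator of F at p, computed in some chart of the atlas around p
  (the value does not depend on the chart).\<close>
definition laplacian :: "('p,'m::finite) chart set \<Rightarrow> ('p,'m) metric \<Rightarrow> ('p \<Rightarrow> real) \<Rightarrow> 'p \<Rightarrow> real" where
  "laplacian A gm F p =
     (let c = (SOME c. c \<in> A \<and> p \<in> fst c) in laplacian_chart gm c (F \<circ> cinv c) (snd c p))"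

definition stochastically_complete :: "'p topology \<Rightarrow> ('p,'m::finite) chart set \<Rightarrow> ('p,'m) metric \<Rightarrow> bool" where
  "stochastically_complete T A gm =
     (\<forall>F. Ck_fun 2 T A F \<and> bdd_above (F ` topspace T) \<longrightarrow>
        (\<exists>p::nat \<Rightarrow> 'p. \<forall>k\<ge>1. p k \<in> topspace T \<and>
            F (p k) > (SUP q\<in>topspace T. F q) - 1 / real k \<and>
            laplacian A gm F (p k) < 1 / real k))"

section \<open>Minimal immersions\<close>

text \<open>Jacobian matrix of the local representative of u in chart c (columns d_i u)\<close>
definition jacobian :: "('p,'m::finite) chart \<Rightarrow> ('p \<Rightarrow> real^'n::finite) \<Rightarrow> real^'m \<Rightarrow> real^'m^'n" where
  "jacobian c u x = (\<chi> a i. pdv i (u \<circ> cinv c) x $ a)"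

text \<open>Induced metric (first fundamental form) of u in chart c\<close>
definition induced_metric :: "('p,'m::finite) chart \<Rightarrow> ('p \<Rightarrow> real^'n::finite) \<Rightarrow> real^'m \<Rightarrow> real^'m^'m" where
  "induced_metric c u x = (\<chi> i j. pdv i (u \<circ> cinv c) x \<bullet> pdv j (u \<circ> cinv c) x)"

text \<open>Orthogonal projection of w onto the tangent space span{d_k u}\<close>
definition tangential :: "('p,'m::finite) chart \<Rightarrow> ('p \<Rightarrow> real^'n::finite) \<Rightarrow> real^'m \<Rightarrow> real^'n \<Rightarrow> real^'n" where
  "tangential c u x w =
     (\<Sum>k\<in>UNIV. \<Sum>l\<in>UNIV. (matrix_inv (induced_metric c u x) $ k $ l * (w \<bullet> pdv l (u \<circ> cinv c) x))
        *\<^sub>R pdv k (u \<circ> cinv c) x)"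

text \<open>Second fundamental form II(d_i,d_j) = normal part of d_i d_j u, and mean curvature vector
  H = (1/m) tr_g II.\<close>
definition second_ff :: "('p,'m::finite) chart \<Rightarrow> ('p \<Rightarrow> real^'n::finite) \<Rightarrow> real^'m \<Rightarrow> 'm \<Rightarrow> 'm \<Rightarrow> real^'n" where
  "second_ff c u x i j =
     (let w = pdv j (pdv i (u \<circ> cinv c)) x in w - tangential c u x w)"

definition mean_curvature :: "('p,'m::finite) chart \<Rightarrow> ('p \<Rightarrow> real^'n::finite) \<Rightarrow> real^'m \<Rightarrow> real^'n" where
  "mean_curvature c u x =
     (1 / real CARD('m)) *\<^sub>R
       (\<Sum>i\<in>UNIV. \<Sum>j\<in>UNIV. matrix_inv (induced_metric c u x) $ i $ j *\<^sub>R second_ff c u x i j)"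

text \<open>Smooth immersion (differential of rank dim M everywhere), isometric for gm, with
  vanishing mean curvature.\<close>
definition minimal_immersion ::
    "'p topology \<Rightarrow> ('p,'m::finite) chart set \<Rightarrow> ('p,'m) metric \<Rightarrow> ('p \<Rightarrow> real^'n::finite) \<Rightarrow> bool" where
  "minimal_immersion T A gm u =
     (smooth_map T A u \<and>
      (\<forall>c\<in>A. \<forall>x\<in>cdom c. rank (jacobian c u x) = CARD('m)) \<and>
      (\<forall>c\<in>A. \<forall>x\<in>cdom c. gm c x = induced_metric c u x) \<and>
      (\<forall>c\<in>A. \<forall>x\<in>cdom c. mean_curvature c u x = 0))"

text \<open>Orthogonal projections of R^n and their rank\<close>
definition orth_projection :: "(real^'n::finite \<Rightarrow> real^'n) \<Rightarrow> bool" where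
  "orth_projection P = (linear P \<and> P \<circ> P = P \<and> (\<forall>x y. P x \<bullet> y = x \<bullet> P y))"

definition rk_map :: "(real^'n::finite \<Rightarrow> real^'k::finite) \<Rightarrow> nat" where
  "rk_map P = dim (range P)"

end

theory Submission
  imports Defs
begin

(*
  Let P be an orthogonal projection and F = |P o u|^2. In a chart, an isometric immersion
  satisfies Delta u = m H, so for a minimal immersion the coordinates of u, hence of P o u,
  are harmonic, and the product rule gives Delta F = 2 g^ij <P d_i u, P d_j u> = 2 trace (P Q),
  where Q is the orthogonal projection onto the tangent space du(T_p M). The rank condition
  makes du(T_p M) and the range of P share a unit vector w, and then
  trace (P Q) = |P Q|^2 >= |P Q w|^2 = 1 (Hilbert-Schmidt norm). Hence Delta F >= 2 on M.
  If P o u were bounded, F would be bounded above, and stochastic completeness would produce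
  points where Delta F < 1. Part (a) is the case P = id.
*)

section \<open>Partial derivatives\<close>

definition pd_exists :: "'m::finite \<Rightarrow> (real^'m \<Rightarrow> real) \<Rightarrow> real^'m \<Rightarrow> bool" where
  "pd_exists i g x \<longleftrightarrow> (\<lambda>t. g (x + t *\<^sub>R axis i 1)) differentiable (at 0)"

lemma has_pd:
  assumes "pd_exists i g x"
  shows "((\<lambda>t. g (x + t *\<^sub>R axis i 1)) has_real_derivative pd i g x) (at 0)"
  using assms unfolding pd_exists_def pd_def
  by (simp add: DERIV_deriv_iff_real_differentiable)

lemma pd_eqI:
  assumes "((\<lambda>t. g (x + t *\<^sub>R axis i 1)) has_real_derivative D) (at 0)"
  shows "pd i g x = D" "pd_exists i g x"
  using assms unfolding pd_exists_def pd_def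
  by (auto simp: DERIV_imp_deriv real_differentiable_def)

lemma eventually_line_in_open:
  fixes x v :: "'a::real_normed_vector"
  assumes "open U" "x \<in> U"
  shows "\<forall>\<^sub>F t in nhds 0. x + t *\<^sub>R v \<in> U"
proof -
  have "open ((\<lambda>t::real. x + t *\<^sub>R v) -` U)"
    by (rule open_vimage[OF assms(1)]) (intro continuous_intros)
  then show ?thesis
    using assms(2) unfolding eventually_nhds by (intro exI[of _ "(\<lambda>t::real. x + t *\<^sub>R v) -` U"]) auto
qed

lemma pd_cong:
  assumes "open U" "x \<in> U" "\<And>y. y \<in> U \<Longrightarrow> g y = h y"
  shows "pd i g x = pd i h x" "pd_exists i g x \<longleftrightarrow> pd_exists i h x"
proof -
  have "\<forall>\<^sub>F t in nhds 0. g (x + t *\<^sub>R axis i 1) = h (x + t *\<^sub>R axis i 1)"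
    using eventually_line_in_open[OF assms(1,2), of "axis i 1"] assms(3) by (auto elim: eventually_mono)
  then have "((\<lambda>t. g (x + t *\<^sub>R axis i 1)) has_real_derivative D) (at 0) \<longleftrightarrow>
             ((\<lambda>t. h (x + t *\<^sub>R axis i 1)) has_real_derivative D) (at 0)" for D
    by (intro DERIV_cong_ev) auto
  then show "pd i g x = pd i h x" "pd_exists i g x \<longleftrightarrow> pd_exists i h x"
    unfolding pd_def deriv_def pd_exists_def real_differentiable_def by simp_all
qed

lemma pd_add:
  assumes "pd_exists i g x" "pd_exists i h x"
  shows "pd i (\<lambda>y. g y + h y) x = pd i g x + pd i h x" "pd_exists i (\<lambda>y. g y + h y) x"
  using pd_eqI[OF DERIV_add[OF has_pd[OF assms(1)] has_pd[OF assms(2)]]] by auto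

lemma pd_mult:
  assumes "pd_exists i g x" "pd_exists i h x"
  shows "pd i (\<lambda>y. g y * h y) x = pd i g x * h x + g x * pd i h x"
    "pd_exists i (\<lambda>y. g y * h y) x"
  using pd_eqI[OF DERIV_mult[OF has_pd[OF assms(1)] has_pd[OF assms(2)]]] by (auto simp: mult.commute)

lemma pd_const: "pd i (\<lambda>y. c) x = 0" "pd_exists i (\<lambda>y. c) x"
  using pd_eqI[of "\<lambda>y. c" x i 0] by auto

lemma pd_cmult:
  assumes "pd_exists i g x"
  shows "pd i (\<lambda>y. c * g y) x = c * pd i g x" "pd_exists i (\<lambda>y. c * g y) x"
  using pd_mult[OF pd_const(2) assms, of c] pd_const by auto

lemma pd_sum:
  assumes "finite S" "\<And>s. s \<in> S \<Longrightarrow> pd_exists i (g s) x"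
  shows "pd i (\<lambda>y. \<Sum>s\<in>S. g s y) x = (\<Sum>s\<in>S. pd i (g s) x)"
    "pd_exists i (\<lambda>y. \<Sum>s\<in>S. g s y) x"
proof -
  have "pd i (\<lambda>y. \<Sum>s\<in>S. g s y) x = (\<Sum>s\<in>S. pd i (g s) x) \<and> pd_exists i (\<lambda>y. \<Sum>s\<in>S. g s y) x"
    using assms
  proof (induction S rule: finite_induct)
    case empty
    then show ?case using pd_const[of i 0 x] by simp
  next
    case (insert a S)
    then show ?case using pd_add[of i "g a" x "\<lambda>y. \<Sum>s\<in>S. g s y"] by simp
  qed
  then show "pd i (\<lambda>y. \<Sum>s\<in>S. g s y) x = (\<Sum>s\<in>S. pd i (g s) x)"
    "pd_exists i (\<lambda>y. \<Sum>s\<in>S. g s y) x"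
    by simp_all
qed

lemma pd_inner:
  assumes "\<And>b. pd_exists i (\<lambda>y. f y $ b) x" "\<And>b. pd_exists i (\<lambda>y. g y $ b) x"
  shows "pd i (\<lambda>y. f y \<bullet> g y) x = pdv i f x \<bullet> g x + f x \<bullet> pdv i g x"
proof -
  have "pd i (\<lambda>y. f y \<bullet> g y) x = (\<Sum>b\<in>UNIV. pd i (\<lambda>y. f y $ b * g y $ b) x)"
    unfolding inner_vec_def inner_real_def by (rule pd_sum) (auto intro: pd_mult assms)
  then show ?thesis
    by (simp add: pd_mult(1)[OF assms] pdv_def inner_vec_def sum.distrib)
qed

lemma linear_vec_nth:
  fixes P :: "real^'n::finite \<Rightarrow> real^'k::finite"
  assumes "linear P"
  shows "P v $ a = (\<Sum>b\<in>UNIV. matrix P $ a $ b * v $ b)"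
proof -
  have "P v = matrix P *v v"
    using assms by (simp add: matrix_works linear_matrix_vector_mul_eq)
  then show ?thesis by (simp add: matrix_vector_mult_def)
qed

lemma pdv_linear:
  fixes P :: "real^'n::finite \<Rightarrow> real^'k::finite"
  assumes "linear P" "\<And>b. pd_exists i (\<lambda>y. f y $ b) x"
  shows "pdv i (\<lambda>y. P (f y)) x = P (pdv i f x)"
proof -
  have "pd i (\<lambda>y. P (f y) $ a) x = (\<Sum>b\<in>UNIV. pd i (\<lambda>y. matrix P $ a $ b * f y $ b) x)" for a
    unfolding linear_vec_nth[OF assms(1)] by (rule pd_sum) (auto intro: pd_cmult assms(2))
  then show ?thesis
    by (simp add: vec_eq_iff pdv_def pd_cmult(1)[OF assms(2)] linear_vec_nth[OF assms(1)])
qed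

section \<open>Functions of class C^k\<close>

lemma Ck_Suc_iff:
  "Ck (Suc k) U f \<longleftrightarrow> continuous_on U f \<and> (\<forall>i. (\<forall>x\<in>U. pd_exists i f x) \<and> Ck k U (pd i f))"
  by (simp add: pd_exists_def)

declare Ck.simps(2)[simp del]

lemma Ck_imp_continuous_on: "Ck k U f \<Longrightarrow> continuous_on U f"
  by (cases k) (auto simp: Ck_Suc_iff)

lemma Ck_Suc_imp_Ck: "Ck (Suc k) U f \<Longrightarrow> Ck k U f"
  by (induction k arbitrary: f) (auto simp: Ck_Suc_iff)

lemma Ck2_pd_exists:
  assumes "Ck 2 U f" "x \<in> U"
  shows "pd_exists i f x" "pd_exists j (pd i f) x"
  using assms by (auto simp: Ck_Suc_iff numeral_2_eq_2)

lemma Ck_cong: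
  assumes "open U" "\<And>y. y \<in> U \<Longrightarrow> f y = g y" "Ck k U f"
  shows "Ck k U g"
  using assms(2,3)
proof (induction k arbitrary: f g)
  case 0
  then show ?case using continuous_on_cong by auto
next
  case (Suc k)
  have "continuous_on U g"
    using Suc.prems continuous_on_cong Ck_imp_continuous_on by metis
  moreover have "\<forall>x\<in>U. pd_exists i g x" for i
    using Suc.prems pd_cong(2)[OF assms(1), of _ f g i] by (auto simp: Ck_Suc_iff)
  moreover have "Ck k U (pd i g)" for i
    using Suc.IH[of "pd i f" "pd i g"] Suc.prems pd_cong(1)[OF assms(1), of _ f g i]
    by (auto simp: Ck_Suc_iff)
  ultimately show ?case by (simp add: Ck_Suc_iff)
qed

lemma Ck_const: "Ck k U (\<lambda>y. c)"
proof (induction k arbitrary: c)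
  case 0
  then show ?case by simp
next
  case (Suc k)
  then show ?case by (simp add: Ck_Suc_iff pd_const(1)[abs_def] pd_const(2))
qed

lemma Ck_add:
  assumes "open U" "Ck k U f" "Ck k U g"
  shows "Ck k U (\<lambda>y. f y + g y)"
  using assms(2,3)
proof (induction k arbitrary: f g)
  case 0
  then show ?case by (simp add: continuous_on_add)
next
  case (Suc k)
  have "Ck k U (pd i (\<lambda>y. f y + g y))" for i
  proof (rule Ck_cong[OF assms(1)])
    show "Ck k U (\<lambda>y. pd i f y + pd i g y)" using Suc by (auto simp: Ck_Suc_iff)
    show "pd i f y + pd i g y = pd i (\<lambda>y. f y + g y) y" if "y \<in> U" for y
      using Suc.prems that by (auto simp: Ck_Suc_iff pd_add(1))
  qed
  then show ?case
    using Suc.prems by (auto simp: Ck_Suc_iff pd_add(2) intro: continuous_on_add)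
qed

lemma Ck_mult:
  assumes "open U" "Ck k U f" "Ck k U g"
  shows "Ck k U (\<lambda>y. f y * g y)"
  using assms(2,3)
proof (induction k arbitrary: f g)
  case 0
  then show ?case by (simp add: continuous_on_mult)
next
  case (Suc k)
  have "Ck k U (pd i (\<lambda>y. f y * g y))" for i
  proof (rule Ck_cong[OF assms(1)])
    show "Ck k U (\<lambda>y. pd i f y * g y + f y * pd i g y)"
      using Suc.prems Ck_Suc_imp_Ck[OF Suc.prems(1)] Ck_Suc_imp_Ck[OF Suc.prems(2)]
      by (intro Ck_add[OF assms(1)] Suc.IH) (auto simp: Ck_Suc_iff)
    show "pd i f y * g y + f y * pd i g y = pd i (\<lambda>y. f y * g y) y" if "y \<in> U" for y
      using Suc.prems that by (auto simp: Ck_Suc_iff pd_mult(1))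
  qed
  then show ?case
    using Suc.prems by (auto simp: Ck_Suc_iff pd_mult(2) intro: continuous_on_mult)
qed

lemma Ck_sum:
  assumes "open U" "finite S" "\<And>s. s \<in> S \<Longrightarrow> Ck k U (g s)"
  shows "Ck k U (\<lambda>y. \<Sum>s\<in>S. g s y)"
  using assms(2,3)
proof (induction S rule: finite_induct)
  case empty
  then show ?case using Ck_const by simp
next
  case (insert a S)
  then show ?case using Ck_add[OF assms(1)] by simp
qed

lemma CkV_linear:
  fixes P :: "real^'n::finite \<Rightarrow> real^'k::finite"
  assumes "open U" "linear P" "CkV k U f"
  shows "CkV k U (\<lambda>y. P (f y))"
  using assms(3) unfolding CkV_def linear_vec_nth[OF assms(2)]
  by (intro allI Ck_sum[OF assms(1) finite] Ck_mult[OF assms(1) Ck_const]) simp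

lemma Ck_inner:
  assumes "open U" "CkV k U f" "CkV k U g"
  shows "Ck k U (\<lambda>y. f y \<bullet> g y)"
  using assms(2,3) unfolding CkV_def inner_vec_def inner_real_def
  by (intro Ck_sum[OF assms(1) finite] Ck_mult[OF assms(1)]) simp_all

section \<open>Symmetry of second partial derivatives\<close>

lemma norm_axis_combination_le:
  assumes "0 \<le> s" "0 \<le> t"
  shows "norm (s *\<^sub>R axis i (1::real) + t *\<^sub>R axis j 1) \<le> s + t"
  using norm_triangle_ineq[of "s *\<^sub>R axis i (1::real)" "t *\<^sub>R axis j 1"] assms by simp

lemma has_pd_along_line:
  assumes "pd_exists i g (z + s *\<^sub>R axis i 1)"
  shows "((\<lambda>t. g (z + t *\<^sub>R axis i 1)) has_real_derivative pd i g (z + s *\<^sub>R axis i 1)) (at s)"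
proof -
  have "((\<lambda>t. g (z + (t + s) *\<^sub>R axis i 1)) has_real_derivative pd i g (z + s *\<^sub>R axis i 1)) (at 0)"
    using has_pd[OF assms] by (simp add: algebra_simps)
  then show ?thesis
    using DERIV_shift[of "\<lambda>t. g (z + t *\<^sub>R axis i 1)" _ 0 s] by simp
qed

lemma mvt_along_axis:
  assumes "0 < h" "\<And>t. 0 \<le> t \<Longrightarrow> t \<le> h \<Longrightarrow> pd_exists j g (z + t *\<^sub>R axis j 1)"
  obtains \<eta> where "0 < \<eta>" "\<eta> < h" "g (z + h *\<^sub>R axis j 1) - g z = h * pd j g (z + \<eta> *\<^sub>R axis j 1)"
proof -
  have "DERIV (\<lambda>t. g (z + t *\<^sub>R axis j 1)) t :> pd j g (z + t *\<^sub>R axis j 1)" if "0 \<le> t" "t \<le> h" for t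
    using assms(2)[OF that] by (rule has_pd_along_line)
  then show ?thesis
    using MVT2[OF assms(1), of "\<lambda>t. g (z + t *\<^sub>R axis j 1)" "\<lambda>t. pd j g (z + t *\<^sub>R axis j 1)"] that
    by auto
qed

lemma second_difference_mvt:
  fixes f :: "real^'m::finite \<Rightarrow> real"
  assumes U: "ball x r \<subseteq> U" and h: "0 < h" "2 * h < r"
    and d1: "\<And>y. y \<in> U \<Longrightarrow> pd_exists i f y"
    and d2: "\<And>y. y \<in> U \<Longrightarrow> pd_exists j (pd i f) y"
  obtains p where "dist p x < 2 * h"
    "f (x + h *\<^sub>R axis i 1 + h *\<^sub>R axis j 1) - f (x + h *\<^sub>R axis i 1) - f (x + h *\<^sub>R axis j 1) + f x
       = h\<^sup>2 * pd j (pd i f) p"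
proof -
  let ?ei = "axis i (1::real)" and ?ej = "axis j (1::real)"
  have inU: "x + s *\<^sub>R ?ei + t *\<^sub>R ?ej \<in> U" if "0 \<le> s" "s \<le> h" "0 \<le> t" "t \<le> h" for s t
  proof -
    have "norm (s *\<^sub>R ?ei + t *\<^sub>R ?ej) < r"
      using norm_axis_combination_le[of s t i j] that h by linarith
    then have "x + (s *\<^sub>R ?ei + t *\<^sub>R ?ej) \<in> ball x r"
      by (simp add: dist_norm norm_minus_commute add.commute)
    then show ?thesis
      using U by (auto simp: add.assoc)
  qed
  define \<Psi> where "\<Psi> s = f (x + h *\<^sub>R ?ej + s *\<^sub>R ?ei) - f (x + s *\<^sub>R ?ei)" for s
  have "DERIV \<Psi> s :> pd i f (x + h *\<^sub>R ?ej + s *\<^sub>R ?ei) - pd i f (x + s *\<^sub>R ?ei)"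
    if "0 \<le> s" "s \<le> h" for s
    unfolding \<Psi>_def using d1 inU[of s h] inU[of s 0] that h
    by (intro DERIV_diff has_pd_along_line) (simp_all add: algebra_simps)
  then obtain \<xi> where \<xi>: "0 < \<xi>" "\<xi> < h"
     "\<Psi> h - \<Psi> 0 = h * (pd i f (x + h *\<^sub>R ?ej + \<xi> *\<^sub>R ?ei) - pd i f (x + \<xi> *\<^sub>R ?ei))"
    using MVT2[OF h(1), of \<Psi> "\<lambda>s. pd i f (x + h *\<^sub>R ?ej + s *\<^sub>R ?ei) - pd i f (x + s *\<^sub>R ?ei)"]
    by auto
  obtain \<eta> where \<eta>: "0 < \<eta>" "\<eta> < h"
    "pd i f (x + \<xi> *\<^sub>R ?ei + h *\<^sub>R ?ej) - pd i f (x + \<xi> *\<^sub>R ?ei)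
       = h * pd j (pd i f) (x + \<xi> *\<^sub>R ?ei + \<eta> *\<^sub>R ?ej)"
    using mvt_along_axis[OF h(1), of j "pd i f" "x + \<xi> *\<^sub>R ?ei"] d2 inU \<xi> by auto
  show ?thesis
  proof
    show "dist (x + \<xi> *\<^sub>R ?ei + \<eta> *\<^sub>R ?ej) x < 2 * h"
      using norm_axis_combination_le[of \<xi> \<eta> i j] \<xi> \<eta> by (simp add: dist_norm add.assoc)
    have "f (x + h *\<^sub>R ?ei + h *\<^sub>R ?ej) - f (x + h *\<^sub>R ?ei) - f (x + h *\<^sub>R ?ej) + f x = \<Psi> h - \<Psi> 0"
      unfolding \<Psi>_def by (simp add: algebra_simps)
    then show "f (x + h *\<^sub>R ?ei + h *\<^sub>R ?ej) - f (x + h *\<^sub>R ?ei) - f (x + h *\<^sub>R ?ej) + f x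
      = h\<^sup>2 * pd j (pd i f) (x + \<xi> *\<^sub>R ?ei + \<eta> *\<^sub>R ?ej)"
      using \<xi>(3) \<eta>(3) by (simp add: power2_eq_square algebra_simps)
  qed
qed

lemma mixed_pds_meet:
  fixes f :: "real^'m::finite \<Rightarrow> real"
  assumes "open U" "x \<in> U" "Ck 2 U f" "0 < d"
  obtains p q where "dist p x < d" "dist q x < d" "pd j (pd i f) p = pd i (pd j f) q"
proof -
  have "\<And>i y. y \<in> U \<Longrightarrow> pd_exists i f y" "\<And>i j y. y \<in> U \<Longrightarrow> pd_exists j (pd i f) y"
    using Ck2_pd_exists[OF assms(3)] by auto
  moreover obtain r where r: "r > 0" "ball x r \<subseteq> U"
    using assms(1,2) open_contains_ball by blast
  moreover define h where "h = min r d / 3"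
  moreover have h: "0 < h" "2 * h < r" "2 * h \<le> d"
    using r assms(4) by (auto simp: h_def)
  ultimately obtain p q where
    "dist p x < 2 * h" "dist q x < 2 * h"
    "f (x + h *\<^sub>R axis i 1 + h *\<^sub>R axis j 1) - f (x + h *\<^sub>R axis i 1) - f (x + h *\<^sub>R axis j 1) + f x
       = h\<^sup>2 * pd j (pd i f) p"
    "f (x + h *\<^sub>R axis j 1 + h *\<^sub>R axis i 1) - f (x + h *\<^sub>R axis j 1) - f (x + h *\<^sub>R axis i 1) + f x
       = h\<^sup>2 * pd i (pd j f) q"
    using second_difference_mvt[OF r(2) h(1,2), of i f j] second_difference_mvt[OF r(2) h(1,2), of j f i]
    by metis
  then show ?thesis
    using that[of p q] h by (simp add: algebra_simps)
qed

lemma pd_pd_commute: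
  fixes f :: "real^'m::finite \<Rightarrow> real"
  assumes "open U" "x \<in> U" "Ck 2 U f"
  shows "pd j (pd i f) x = pd i (pd j f) x"
proof -
  let ?D1 = "pd j (pd i f)" and ?D2 = "pd i (pd j f)"
  have "continuous_on U (pd j (pd i f))" for i j
    using assms(3) by (auto simp: Ck_Suc_iff numeral_2_eq_2 intro: Ck_imp_continuous_on)
  then have cont: "isCont (pd j (pd i f)) x" for i j
    using assms(1,2) continuous_on_eq_continuous_at by blast
  have "\<bar>?D1 x - ?D2 x\<bar> < 2 * e" if "e > 0" for e
  proof -
    obtain d1 where d1: "d1 > 0" "\<And>y. dist y x < d1 \<Longrightarrow> dist (?D1 y) (?D1 x) < e"
      using cont \<open>e > 0\<close> unfolding continuous_at_eps_delta by blast
    obtain d2 where d2: "d2 > 0" "\<And>y. dist y x < d2 \<Longrightarrow> dist (?D2 y) (?D2 x) < e"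
      using cont \<open>e > 0\<close> unfolding continuous_at_eps_delta by blast
    obtain p q where "dist p x < min d1 d2" "dist q x < min d1 d2" "?D1 p = ?D2 q"
      using mixed_pds_meet[OF assms, where d = "min d1 d2" and i = i and j = j] d1(1) d2(1) by auto
    then show ?thesis
      using d1(2)[of p] d2(2)[of q] by (simp add: dist_real_def)
  qed
  from this[of "\<bar>?D1 x - ?D2 x\<bar> / 2"] show ?thesis
    by (cases "\<bar>?D1 x - ?D2 x\<bar> > 0") auto
qed

lemma pdv_pdv_commute:
  assumes "open U" "x \<in> U" "CkV 2 U f"
  shows "pdv j (pdv i f) x = pdv i (pdv j f) x"
  using pd_pd_commute[OF assms(1,2)] assms(3) by (simp add: CkV_def pdv_def vec_eq_iff)

section \<open>The Laplace-Beltrami operator in a chart\<close>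

lemma pd2_add:
  assumes "open U" "x \<in> U" "Ck 2 U g" "Ck 2 U h"
  shows "pd j (pd i (\<lambda>y. g y + h y)) x = pd j (pd i g) x + pd j (pd i h) x"
proof -
  have "pd j (pd i (\<lambda>y. g y + h y)) x = pd j (\<lambda>y. pd i g y + pd i h y) x"
    using assms by (intro pd_cong(1)) (auto intro: pd_add(1) Ck2_pd_exists)
  also have "\<dots> = pd j (pd i g) x + pd j (pd i h) x"
    using assms by (intro pd_add(1) Ck2_pd_exists)
  finally show ?thesis .
qed

lemma pd2_cmult:
  assumes "open U" "x \<in> U" "Ck 2 U g"
  shows "pd j (pd i (\<lambda>y. c * g y)) x = c * pd j (pd i g) x"
proof -
  have "pd j (pd i (\<lambda>y. c * g y)) x = pd j (\<lambda>y. c * pd i g y) x"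
    using assms by (intro pd_cong(1)) (auto intro: pd_cmult(1) Ck2_pd_exists)
  also have "\<dots> = c * pd j (pd i g) x"
    using assms by (intro pd_cmult(1) Ck2_pd_exists)
  finally show ?thesis .
qed

lemma pd2_mult:
  assumes "open U" "x \<in> U" "Ck 2 U g" "Ck 2 U h"
  shows "pd j (pd i (\<lambda>y. g y * h y)) x
    = pd j (pd i g) x * h x + pd i g x * pd j h x + pd j g x * pd i h x + g x * pd j (pd i h) x"
proof -
  note d = Ck2_pd_exists[OF assms(3,2)] Ck2_pd_exists[OF assms(4,2)]
  have "pd j (pd i (\<lambda>y. g y * h y)) x = pd j (\<lambda>y. pd i g y * h y + g y * pd i h y) x"
    using assms by (intro pd_cong(1)) (auto intro: pd_mult(1) Ck2_pd_exists)
  also have "\<dots> = pd j (\<lambda>y. pd i g y * h y) x + pd j (\<lambda>y. g y * pd i h y) x"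
    using d by (intro pd_add(1) pd_mult(2))
  finally show ?thesis
    using d by (simp add: pd_mult(1))
qed

lemma laplacian_chart_add:
  assumes "open U" "x \<in> U" "Ck 2 U g" "Ck 2 U h"
  shows "laplacian_chart gm c (\<lambda>y. g y + h y) x = laplacian_chart gm c g x + laplacian_chart gm c h x"
  using Ck2_pd_exists[OF assms(3,2)] Ck2_pd_exists[OF assms(4,2)]
  by (simp add: laplacian_chart_def pd2_add[OF assms] pd_add(1)
      algebra_simps sum.distrib sum_subtractf)

lemma laplacian_chart_cmult:
  assumes "open U" "x \<in> U" "Ck 2 U g"
  shows "laplacian_chart gm c (\<lambda>y. a * g y) x = a * laplacian_chart gm c g x"
  using Ck2_pd_exists[OF assms(3,2)]
  by (simp add: laplacian_chart_def pd2_cmult[OF assms] pd_cmult(1)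
      algebra_simps sum_distrib_left sum_subtractf)

lemma laplacian_chart_sum:
  assumes "open U" "x \<in> U" "finite S" "\<And>s. s \<in> S \<Longrightarrow> Ck 2 U (g s)"
  shows "laplacian_chart gm c (\<lambda>y. \<Sum>s\<in>S. g s y) x = (\<Sum>s\<in>S. laplacian_chart gm c (g s) x)"
  using assms(3,4)
proof (induction S rule: finite_induct)
  case empty
  then show ?case by (simp add: laplacian_chart_def pd_const(1)[abs_def])
next
  case (insert a S)
  then have "Ck 2 U (\<lambda>y. \<Sum>s\<in>S. g s y)"
    by (intro Ck_sum[OF assms(1)]) auto
  with insert show ?case
    using laplacian_chart_add[OF assms(1,2), of "g a" "\<lambda>y. \<Sum>s\<in>S. g s y" gm c] by simp
qed

lemma laplacian_chart_mult:
  assumes "open U" "x \<in> U" "Ck 2 U g" "Ck 2 U h"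
  shows "laplacian_chart gm c (\<lambda>y. g y * h y) x
    = g x * laplacian_chart gm c h x + h x * laplacian_chart gm c g x
      + (\<Sum>i\<in>UNIV. \<Sum>j\<in>UNIV. matrix_inv (gm c x) $ i $ j * (pd i g x * pd j h x + pd j g x * pd i h x))"
  using Ck2_pd_exists[OF assms(3,2)] Ck2_pd_exists[OF assms(4,2)]
  by (simp add: laplacian_chart_def pd2_mult[OF assms] pd_mult(1)
      algebra_simps sum.distrib sum_subtractf sum_distrib_left)

definition laplacian_chartV ::
    "('p,'m::finite) metric \<Rightarrow> ('p,'m) chart \<Rightarrow> (real^'m \<Rightarrow> real^'n::finite) \<Rightarrow> real^'m \<Rightarrow> real^'n" where
  "laplacian_chartV gm c f x = (\<chi> b. laplacian_chart gm c (\<lambda>y. f y $ b) x)"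

lemma laplacian_chartV_linear:
  fixes P :: "real^'n::finite \<Rightarrow> real^'k::finite"
  assumes "open U" "x \<in> U" "CkV 2 U f" "linear P"
  shows "laplacian_chartV gm c (\<lambda>y. P (f y)) x = P (laplacian_chartV gm c f x)"
proof -
  have "laplacian_chart gm c (\<lambda>y. P (f y) $ a) x
      = (\<Sum>b\<in>UNIV. laplacian_chart gm c (\<lambda>y. matrix P $ a $ b * f y $ b) x)" for a
    using assms(3) unfolding linear_vec_nth[OF assms(4)] CkV_def
    by (intro laplacian_chart_sum[OF assms(1,2)] Ck_mult[OF assms(1) Ck_const]) auto
  then show ?thesis
    using assms(3) unfolding CkV_def
    by (simp add: laplacian_chartV_def vec_eq_iff linear_vec_nth[OF assms(4)]
        laplacian_chart_cmult[OF assms(1,2)])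
qed

lemma laplacian_chart_inner:
  assumes "open U" "x \<in> U" "CkV 2 U f" "CkV 2 U g"
  shows "laplacian_chart gm c (\<lambda>y. f y \<bullet> g y) x
    = f x \<bullet> laplacian_chartV gm c g x + g x \<bullet> laplacian_chartV gm c f x
      + (\<Sum>i\<in>UNIV. \<Sum>j\<in>UNIV. matrix_inv (gm c x) $ i $ j *
           (pdv i f x \<bullet> pdv j g x + pdv j f x \<bullet> pdv i g x))"
proof -
  let ?G = "matrix_inv (gm c x)"
  have fg: "Ck 2 U (\<lambda>y. f y $ b)" "Ck 2 U (\<lambda>y. g y $ b)" for b
    using assms(3,4) by (auto simp: CkV_def)
  have "laplacian_chart gm c (\<lambda>y. f y \<bullet> g y) x
      = (\<Sum>b\<in>UNIV. laplacian_chart gm c (\<lambda>y. f y $ b * g y $ b) x)"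
    unfolding inner_vec_def inner_real_def
    by (intro laplacian_chart_sum[OF assms(1,2)] Ck_mult[OF assms(1)] fg) auto
  also have "\<dots> = (\<Sum>b\<in>UNIV. f x $ b * laplacian_chart gm c (\<lambda>y. g y $ b) x
        + g x $ b * laplacian_chart gm c (\<lambda>y. f y $ b) x)
      + (\<Sum>b\<in>UNIV. \<Sum>i\<in>UNIV. \<Sum>j\<in>UNIV. ?G $ i $ j *
           (pd i (\<lambda>y. f y $ b) x * pd j (\<lambda>y. g y $ b) x + pd j (\<lambda>y. f y $ b) x * pd i (\<lambda>y. g y $ b) x))"
    by (simp add: laplacian_chart_mult[OF assms(1,2) fg] sum.distrib)
  also have "(\<Sum>b\<in>UNIV. \<Sum>i\<in>UNIV. \<Sum>j\<in>UNIV. ?G $ i $ j *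
           (pd i (\<lambda>y. f y $ b) x * pd j (\<lambda>y. g y $ b) x + pd j (\<lambda>y. f y $ b) x * pd i (\<lambda>y. g y $ b) x))
      = (\<Sum>i\<in>UNIV. \<Sum>j\<in>UNIV. \<Sum>b\<in>UNIV. ?G $ i $ j *
           (pd i (\<lambda>y. f y $ b) x * pd j (\<lambda>y. g y $ b) x + pd j (\<lambda>y. f y $ b) x * pd i (\<lambda>y. g y $ b) x))"
    by (subst sum.swap, subst (2) sum.swap) (rule refl)
  finally show ?thesis
    by (simp add: laplacian_chartV_def pdv_def inner_vec_def sum.distrib sum_distrib_left distrib_left)
qed

section \<open>The Laplacian of an isometric immersion\<close>

lemma pd_induced_metric:
  assumes "CkV 2 U (u \<circ> cinv c)" "x \<in> U"
  shows "pd i (\<lambda>y. induced_metric c u y $ j $ l) x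
    = pdv i (pdv j (u \<circ> cinv c)) x \<bullet> pdv l (u \<circ> cinv c) x
      + pdv j (u \<circ> cinv c) x \<bullet> pdv i (pdv l (u \<circ> cinv c)) x"
proof -
  have "pd_exists i (pd j (\<lambda>y. (u \<circ> cinv c) y $ b)) x" for j b
    using assms unfolding CkV_def by (blast intro: Ck2_pd_exists(2))
  then have "pd_exists i (\<lambda>y. pdv j (u \<circ> cinv c) y $ b) x" for j b
    by (simp add: pdv_def)
  then show ?thesis
    by (simp add: induced_metric_def pd_inner)
qed

lemma christoffel_induced_metric:
  assumes "open U" "x \<in> U" "CkV 2 U (u \<circ> cinv c)"
    and gm: "\<And>y. y \<in> U \<Longrightarrow> gm c y = induced_metric c u y"
  shows "christoffel gm c x k i j
    = (\<Sum>l\<in>UNIV. matrix_inv (gm c x) $ k $ l *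
         (pdv j (pdv i (u \<circ> cinv c)) x \<bullet> pdv l (u \<circ> cinv c) x))"
proof -
  define D where "D i j = pdv j (pdv i (u \<circ> cinv c)) x" for i j
  define a where "a l = pdv l (u \<circ> cinv c) x" for l
  have dg: "pd i (\<lambda>y. gm c y $ j $ l) x = D j i \<bullet> a l + a j \<bullet> D l i" for i j l
  proof -
    have "pd i (\<lambda>y. gm c y $ j $ l) x = pd i (\<lambda>y. induced_metric c u y $ j $ l) x"
      using assms(1,2) gm by (intro pd_cong(1)) auto
    then show ?thesis
      using pd_induced_metric[OF assms(3,2)] by (simp add: D_def a_def)
  qed
  have D_sym: "D i j = D j i" for i j
    unfolding D_def by (rule pdv_pdv_commute[OF assms(1-3)])
  have "pd i (\<lambda>y. gm c y $ j $ l) x + pd j (\<lambda>y. gm c y $ i $ l) x - pd l (\<lambda>y. gm c y $ i $ j) x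
      = 2 * (D i j \<bullet> a l)" for l
    unfolding dg using D_sym[of i j] D_sym[of i l] D_sym[of j l] by (simp add: inner_commute)
  then show ?thesis
    by (simp add: christoffel_def D_def a_def sum_distrib_left)
qed

lemma second_ff_induced_metric:
  assumes "open U" "x \<in> U" "CkV 2 U (u \<circ> cinv c)"
    and gm: "\<And>y. y \<in> U \<Longrightarrow> gm c y = induced_metric c u y"
  shows "second_ff c u x i j
    = pdv j (pdv i (u \<circ> cinv c)) x - (\<Sum>k\<in>UNIV. christoffel gm c x k i j *\<^sub>R pdv k (u \<circ> cinv c) x)"
  using gm[OF assms(2)]
  by (simp add: second_ff_def Let_def tangential_def christoffel_induced_metric[of U x u c gm, OF assms]
      scaleR_sum_left)

lemma laplacian_chartV_eq_mean_curvature: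
  fixes c :: "('p, 'm::finite) chart"
  assumes "open U" "x \<in> U" "CkV 2 U (u \<circ> cinv c)"
    and gm: "\<And>y. y \<in> U \<Longrightarrow> gm c y = induced_metric c u y"
  shows "laplacian_chartV gm c (u \<circ> cinv c) x = real CARD('m) *\<^sub>R mean_curvature c u x"
proof -
  have "real CARD('m) *\<^sub>R mean_curvature c u x
      = (\<Sum>i\<in>UNIV. \<Sum>j\<in>UNIV. matrix_inv (gm c x) $ i $ j *\<^sub>R second_ff c u x i j)"
    using gm[OF assms(2)] by (simp add: mean_curvature_def)
  then show ?thesis
    by (simp add: vec_eq_iff laplacian_chartV_def laplacian_chart_def pdv_def sum_component
        second_ff_induced_metric[of U x u c gm, OF assms] right_diff_distrib sum_distrib_left)
qed

section \<open>A trace inequality for orthogonal projections\<close>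

lemma trace_mul_transpose_ge_1:
  fixes N :: "real^'n::finite^'n"
  assumes "w \<noteq> 0" "N *v w = w"
  shows "1 \<le> trace (N ** transpose N)"
proof -
  have row: "(N *v w) $ r = N $ r \<bullet> w" for r
    by (simp add: matrix_vector_mult_def inner_vec_def mult.commute)
  have "w \<bullet> w = (N *v w) \<bullet> (N *v w)" using assms by simp
  also have "\<dots> = (\<Sum>r\<in>UNIV. (N $ r \<bullet> w)\<^sup>2)" by (simp add: inner_vec_def row power2_eq_square)
  also have "\<dots> \<le> (\<Sum>r\<in>UNIV. (N $ r \<bullet> N $ r) * (w \<bullet> w))"
    by (intro sum_mono) (metis Cauchy_Schwarz_ineq)
  also have "\<dots> = trace (N ** transpose N) * (w \<bullet> w)"
    by (simp add: trace_def matrix_matrix_mult_def transpose_def inner_vec_def sum_distrib_right)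
  finally show ?thesis
    using assms(1) by simp
qed

lemma trace_projections_ge_1:
  fixes P Q :: "real^'n::finite^'n"
  assumes "transpose P = P" "P ** P = P" "transpose Q = Q" "Q ** Q = Q"
    and "w \<noteq> 0" "P *v w = w" "Q *v w = w"
  shows "1 \<le> trace (P ** Q)"
proof -
  have "(P ** Q) *v w = w"
    using assms(6,7) by (simp add: matrix_vector_mul_assoc[symmetric])
  then have "1 \<le> trace ((P ** Q) ** transpose (P ** Q))"
    by (rule trace_mul_transpose_ge_1[OF assms(5)])
  also have "(P ** Q) ** transpose (P ** Q) = P ** (Q ** Q) ** P"
    using assms(1,3) by (simp add: matrix_transpose_mul matrix_mul_assoc)
  also have "\<dots> = P ** Q ** P"
    using assms(4) by simp
  also have "trace (P ** Q ** P) = trace (P ** (P ** Q))"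
    by (rule trace_mul_sym)
  also have "\<dots> = trace (P ** Q)"
    using assms(2) by (simp add: matrix_mul_assoc)
  finally show ?thesis .
qed

lemma subspace_inter_nonzero:
  fixes S T :: "'a::euclidean_space set"
  assumes "subspace S" "subspace T" "DIM('a) < dim S + dim T"
  obtains w where "w \<in> S" "w \<in> T" "w \<noteq> 0"
proof -
  have "dim {x + y |x y. x \<in> S \<and> y \<in> T} \<le> DIM('a)"
    by (rule eucl.dim_subset_UNIV)
  then have "\<not> S \<inter> T \<subseteq> {0}"
    using dim_sums_Int[OF assms(1,2)] assms(3) dim_eq_0[of "S \<inter> T"] by linarith
  then show ?thesis
    using that by blast
qed

lemma invertible_gram_matrix:
  fixes A :: "real^'m::finite^'n::finite"
  assumes "rank A = CARD('m)"
  shows "invertible (transpose A ** A)"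
proof -
  have injA: "inj ((*v) A)"
    using assms full_rank_injective by blast
  have "inj ((*v) (transpose A ** A))"
  proof (rule injI)
    fix v w
    assume "(transpose A ** A) *v v = (transpose A ** A) *v w"
    then have "(v - w) \<bullet> ((transpose A ** A) *v (v - w)) = 0"
      by (simp add: matrix_vector_mult_diff_distrib)
    moreover have "(v - w) \<bullet> ((transpose A ** A) *v (v - w)) = (A *v (v - w)) \<bullet> (A *v (v - w))"
      by (simp add: matrix_vector_mul_assoc[symmetric]) (metis dot_lmul_matrix inner_commute)
    ultimately have "A *v v = A *v w"
      by (simp add: matrix_vector_mult_diff_distrib)
    then show "v = w"
      using injA by (simp add: inj_eq)
  qed
  then obtain B where "B ** (transpose A ** A) = mat 1"
    using matrix_left_invertible_injective by blast
  then show ?thesis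
    unfolding invertible_def using matrix_left_right_inverse by blast
qed

lemma column_space_projection:
  fixes A :: "real^'m::finite^'n::finite"
  assumes "rank A = CARD('m)"
  defines "Q \<equiv> A ** matrix_inv (transpose A ** A) ** transpose A"
  shows "transpose Q = Q" "Q ** A = A" "Q ** Q = Q"
proof -
  let ?G = "transpose A ** A"
  have "?G ** matrix_inv ?G = mat 1 \<and> matrix_inv ?G ** ?G = mat 1"
    using invertible_gram_matrix[OF assms(1)] unfolding invertible_def matrix_inv_def by (rule someI_ex)
  then have G: "?G ** matrix_inv ?G = mat 1" "matrix_inv ?G ** ?G = mat 1"
    by simp_all
  have "transpose (matrix_inv ?G) ** ?G = mat 1"
    using arg_cong[OF G(1), of transpose] by (simp add: matrix_transpose_mul)
  then have "transpose (matrix_inv ?G) = matrix_inv ?G"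
    by (metis G(1) matrix_mul_assoc matrix_mul_lid matrix_mul_rid)
  then show "transpose Q = Q"
    unfolding Q_def by (simp add: matrix_transpose_mul matrix_mul_assoc)
  show "Q ** A = A"
    unfolding Q_def by (metis G(2) matrix_mul_assoc matrix_mul_rid)
  then show "Q ** Q = Q"
    unfolding Q_def by (metis matrix_mul_assoc)
qed

lemma orth_projection_matrix:
  assumes "orth_projection P"
  shows "matrix P *v v = P v" "transpose (matrix P) = matrix P" "matrix P ** matrix P = matrix P"
proof -
  have lin: "linear P" and idem: "P \<circ> P = P" and sym: "\<And>x y. P x \<bullet> y = x \<bullet> P y"
    using assms by (auto simp: orth_projection_def)
  show "matrix P *v v = P v"
    using lin by (simp add: matrix_works linear_matrix_vector_mul_eq)
  have "P (axis j 1) $ i = P (axis i 1) $ j" for i j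
    using sym[of "axis j 1" "axis i 1"] by (simp add: inner_axis inner_axis')
  then show "transpose (matrix P) = matrix P"
    by (simp add: transpose_def matrix_def vec_eq_iff)
  show "matrix P ** matrix P = matrix P"
    using matrix_compose[OF lin lin] idem by simp
qed

lemma transpose_mul_nth: "(transpose A ** B) $ j $ i = column j A \<bullet> column i B"
  for A :: "real^'m::finite^'n::finite" and B :: "real^'k::finite^'n"
  by (simp add: matrix_matrix_mult_def transpose_def column_def inner_vec_def)

lemma column_mul: "column i (M ** A) = M *v column i A"
  for M :: "real^'n::finite^'k::finite" and A :: "real^'m::finite^'n"
  by (simp add: matrix_matrix_mult_def matrix_vector_mult_def column_def vec_eq_iff)

lemma trace_gram_projection_ge_1:
  fixes A :: "real^'m::finite^'n::finite" and P :: "real^'n \<Rightarrow> real^'n"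
  assumes "rank A = CARD('m)" "orth_projection P"
    and "CARD('n) < CARD('m) + rk_map P"
  shows "1 \<le> (\<Sum>i\<in>UNIV. \<Sum>j\<in>UNIV.
                 matrix_inv (transpose A ** A) $ i $ j * (P (column i A) \<bullet> P (column j A)))"
proof -
  define G where "G = matrix_inv (transpose A ** A)"
  define Q where "Q = A ** G ** transpose A"
  note Q = column_space_projection[OF assms(1), folded G_def, folded Q_def]
  note Pm = orth_projection_matrix[OF assms(2)]
  have linP: "linear P" and idem: "\<And>v. P (P v) = P v" and sym: "\<And>v w. P v \<bullet> w = v \<bullet> P w"
    using assms(2) by (auto simp: orth_projection_def fun_eq_iff)
  have "DIM(real^'n) < dim (range ((*v) A)) + dim (range P)"
    using assms(1,3) by (simp add: rank_dim_range[symmetric] rk_map_def)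
  then obtain w where w: "w \<in> range ((*v) A)" "w \<in> range P" "w \<noteq> 0"
    using subspace_inter_nonzero[of "range ((*v) A)" "range P"] linP
    by (metis linear_subspace_image matrix_vector_mul_linear subspace_UNIV)
  have "Q *v w = w"
    using w(1) Q(2) by (auto simp: matrix_vector_mul_assoc)
  moreover have "matrix P *v w = w"
    using w(2) idem by (auto simp: Pm(1))
  ultimately have "1 \<le> trace (matrix P ** Q)"
    using trace_projections_ge_1[OF Pm(2,3) Q(1,3) w(3)] by blast
  also have "trace (matrix P ** Q) = trace (G ** (transpose A ** (matrix P ** A)))"
    unfolding Q_def by (metis matrix_mul_assoc trace_mul_sym)
  also have "\<dots> = (\<Sum>i\<in>UNIV. \<Sum>j\<in>UNIV. G $ i $ j * (P (column i A) \<bullet> P (column j A)))"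
    using sym idem
    by (simp add: trace_def matrix_matrix_mult_def[of G] transpose_mul_nth column_mul Pm(1) inner_commute)
  finally show ?thesis
    unfolding G_def .
qed

section \<open>Minimal immersions of stochastically complete manifolds\<close>

lemma jacobian_column: "column i (jacobian c u x) = pdv i (u \<circ> cinv c) x"
  by (simp add: jacobian_def column_def vec_eq_iff)

lemma induced_metric_eq_gram: "induced_metric c u x = transpose (jacobian c u x) ** jacobian c u x"
  by (simp add: vec_eq_iff induced_metric_def transpose_mul_nth jacobian_column)

lemma laplacian_chart_norm_sq_linear_minimal:
  fixes c :: "('p, 'm::finite) chart" and P :: "real^'n::finite \<Rightarrow> real^'k::finite"
  assumes "open U" "x \<in> U" "CkV 2 U (u \<circ> cinv c)"
    and "\<And>y. y \<in> U \<Longrightarrow> gm c y = induced_metric c u y" "mean_curvature c u x = 0"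
    and "linear P"
  shows "laplacian_chart gm c (\<lambda>y. P ((u \<circ> cinv c) y) \<bullet> P ((u \<circ> cinv c) y)) x
    = 2 * (\<Sum>i\<in>UNIV. \<Sum>j\<in>UNIV. matrix_inv (gm c x) $ i $ j *
             (P (pdv i (u \<circ> cinv c) x) \<bullet> P (pdv j (u \<circ> cinv c) x)))"
proof -
  let ?f = "u \<circ> cinv c"
  have Pf: "CkV 2 U (\<lambda>y. P (?f y))"
    by (rule CkV_linear[OF assms(1,6,3)])
  have "laplacian_chartV gm c (\<lambda>y. P (?f y)) x = P (real CARD('m) *\<^sub>R mean_curvature c u x)"
    using laplacian_chartV_linear[OF assms(1-3,6), of gm c]
      laplacian_chartV_eq_mean_curvature[of U x u c gm, OF assms(1-4)]
    by simp
  then have harmonic: "laplacian_chartV gm c (\<lambda>y. P (?f y)) x = 0"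
    using assms(5,6) by (simp add: linear_0)
  have "pdv i (\<lambda>y. P (?f y)) x = P (pdv i ?f x)" for i
    using assms(2,3) unfolding CkV_def by (intro pdv_linear[OF assms(6)] Ck2_pd_exists(1)) blast+
  then show ?thesis
    using laplacian_chart_inner[OF assms(1,2) Pf Pf, of gm c] harmonic
    by (simp add: inner_commute mult_2[symmetric] sum_distrib_left mult.left_commute)
qed

lemma open_chart_domain: "smooth_atlas T A \<Longrightarrow> c \<in> A \<Longrightarrow> open (cdom c)"
  by (simp add: smooth_atlas_def is_chart_def cdom_def)

lemma smooth_map_CkV: "smooth_map T A u \<Longrightarrow> c \<in> A \<Longrightarrow> CkV k (cdom c) (u \<circ> cinv c)"
  by (simp add: smooth_map_def smoothV_on_def)

lemma laplacian_in_chart: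
  assumes "smooth_atlas T A" "p \<in> topspace T"
  obtains c where "c \<in> A" "snd c p \<in> cdom c"
    "laplacian A gm F p = laplacian_chart gm c (F \<circ> cinv c) (snd c p)"
proof -
  define c where "c = (SOME c. c \<in> A \<and> p \<in> fst c)"
  have "\<exists>c. c \<in> A \<and> p \<in> fst c"
    using assms unfolding smooth_atlas_def by blast
  then have "c \<in> A \<and> p \<in> fst c"
    unfolding c_def by (rule someI_ex)
  moreover have "laplacian A gm F p = laplacian_chart gm c (F \<circ> cinv c) (snd c p)"
    unfolding laplacian_def c_def Let_def ..
  ultimately show ?thesis
    using that[of c] by (simp add: cdom_def)
qed

lemma Ck_fun_norm_sq_linear:
  fixes u :: "'p \<Rightarrow> real^'n::finite" and P :: "real^'n \<Rightarrow> real^'k::finite"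
  assumes "smooth_atlas T A" "smooth_map T A u" "linear P"
  shows "Ck_fun k T A (\<lambda>p. P (u p) \<bullet> P (u p))"
  unfolding Ck_fun_def comp_def
proof
  fix c assume c: "c \<in> A"
  note U = open_chart_domain[OF assms(1) c]
  show "Ck k (cdom c) (\<lambda>y. P (u (cinv c y)) \<bullet> P (u (cinv c y)))"
    using Ck_inner[OF U, of k "\<lambda>y. P ((u \<circ> cinv c) y)"]
      CkV_linear[OF U assms(3) smooth_map_CkV[OF assms(2) c]]
    by simp
qed

lemma laplacian_norm_sq_projection_ge_2:
  fixes A :: "('p, 'm::finite) chart set" and u :: "'p \<Rightarrow> real^'n::finite"
  assumes "smooth_atlas T A" "minimal_immersion T A gm u" "p \<in> topspace T"
    and "orth_projection P" "CARD('n) < CARD('m) + rk_map P"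
  shows "2 \<le> laplacian A gm (\<lambda>p. P (u p) \<bullet> P (u p)) p"
proof -
  obtain c where c: "c \<in> A" "snd c p \<in> cdom c"
    and lap: "laplacian A gm (\<lambda>p. P (u p) \<bullet> P (u p)) p
      = laplacian_chart gm c ((\<lambda>p. P (u p) \<bullet> P (u p)) \<circ> cinv c) (snd c p)"
    using laplacian_in_chart[OF assms(1,3)] by blast
  let ?x = "snd c p" and ?J = "jacobian c u (snd c p)"
  have mi: "smooth_map T A u" "rank ?J = CARD('m)" "mean_curvature c u ?x = 0"
    "\<And>y. y \<in> cdom c \<Longrightarrow> gm c y = induced_metric c u y"
    using assms(2) c by (auto simp: minimal_immersion_def)
  have "laplacian_chart gm c ((\<lambda>p. P (u p) \<bullet> P (u p)) \<circ> cinv c) ?x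
      = 2 * (\<Sum>i\<in>UNIV. \<Sum>j\<in>UNIV. matrix_inv (transpose ?J ** ?J) $ i $ j *
             (P (column i ?J) \<bullet> P (column j ?J)))"
    using laplacian_chart_norm_sq_linear_minimal[of "cdom c" ?x u c gm P,
        OF open_chart_domain[OF assms(1) c(1)] c(2) smooth_map_CkV[OF mi(1) c(1)] mi(4) mi(3)]
      assms(4) mi(4)[OF c(2)]
    by (simp add: comp_def orth_projection_def jacobian_column induced_metric_eq_gram)
  also have "\<dots> \<ge> 2"
    using trace_gram_projection_ge_1[OF mi(2) assms(4,5)] by simp
  finally show ?thesis
    using lap by simp
qed

lemma stochastically_complete_not_bdd_above:
  assumes "stochastically_complete T A gm" "Ck_fun 2 T A F" "0 < e"
    and "\<And>p. p \<in> topspace T \<Longrightarrow> e \<le> laplacian A gm F p"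
  shows "\<not> bdd_above (F ` topspace T)"
proof
  assume "bdd_above (F ` topspace T)"
  then obtain q where q: "\<And>k. k \<ge> 1 \<Longrightarrow> q k \<in> topspace T \<and> laplacian A gm F (q k) < 1 / real k"
    using assms(1,2) unfolding stochastically_complete_def by blast
  obtain k :: nat where "k \<noteq> 0" "inverse (real k) < e"
    using real_arch_inverse assms(3) by blast
  then show False
    using q[of k] assms(4) by (force simp: inverse_eq_divide)
qed

lemma bounded_imp_bdd_above_inner_self:
  assumes "bounded (f ` S)"
  shows "bdd_above ((\<lambda>x. f x \<bullet> f x) ` S)"
proof -
  obtain B where B: "\<And>x. x \<in> S \<Longrightarrow> norm (f x) \<le> B"
    using assms by (auto simp: bounded_iff)
  have "f x \<bullet> f x \<le> B\<^sup>2" if "x \<in> S" for x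
  proof -
    have "(norm (f x))\<^sup>2 \<le> B\<^sup>2"
      using B[OF that] by (intro power_mono) auto
    then show ?thesis
      by (simp add: power2_norm_eq_inner)
  qed
  then show ?thesis
    by (rule bdd_aboveI2)
qed

theorem mainTheorem3:
  fixes T :: "'p topology"
    and A :: "('p, 'm::finite) chart set"
    and gm :: "('p, 'm) metric"
    and u :: "'p \<Rightarrow> real^'n::finite"
  assumes "smooth_manifold T A"
    and "connected_space T"
    and "riemannian_metric T A gm"
    and "stochastically_complete T A gm"
    and "minimal_immersion T A gm u"
  shows "\<not> bounded (u ` topspace T) \<and>
         (\<forall>P :: real^'n \<Rightarrow> real^'n. orth_projection P \<and>
             int CARD('m) + int (rk_map P) - int CARD('n) \<ge> 1 \<longrightarrow>
             \<not> bounded ((P \<circ> u) ` topspace T))"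
proof -
  have atlas: "smooth_atlas T A"
    using assms(1) by (simp add: smooth_manifold_def)
  have projection_unbounded: "\<not> bounded ((P \<circ> u) ` topspace T)"
    if P: "orth_projection P" "int CARD('m) + int (rk_map P) - int CARD('n) \<ge> 1" for P
  proof
    assume "bounded ((P \<circ> u) ` topspace T)"
    then have "bdd_above ((\<lambda>p. P (u p) \<bullet> P (u p)) ` topspace T)"
      using bounded_imp_bdd_above_inner_self[of "P \<circ> u"] by simp
    moreover have "Ck_fun 2 T A (\<lambda>p. P (u p) \<bullet> P (u p))"
      using assms(5) P(1) by (intro Ck_fun_norm_sq_linear[OF atlas])
        (auto simp: minimal_immersion_def orth_projection_def)
    moreover have "2 \<le> laplacian A gm (\<lambda>p. P (u p) \<bullet> P (u p)) p" if "p \<in> topspace T" for p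
      using P by (intro laplacian_norm_sq_projection_ge_2[OF atlas assms(5) that]) auto
    ultimately show False
      using stochastically_complete_not_bdd_above[OF assms(4), of _ 2] by simp
  qed
  moreover have "\<not> bounded (u ` topspace T)"
    using projection_unbounded[of id] by (simp add: orth_projection_def rk_map_def linear_id)
  ultimately show ?thesis
    by blast
qed

end
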